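(* Let $(V,V^+)$ be an ordered $*$-vector space with an order unit $e$, and let $V_{\mathrm{Arch}}$ be the Archimedeanization of $V$. Then there exists a unital surjective positive linear map $q : V \to V_{\mathrm{Arch}}$ with the following property: whenever $(W,W^+)$ is an ordered $*$-vector space with Archimedean order unit $e'$ and $\phi : V \to W$ is a unital positive linear map, there exists a unique positive linear map $\widetilde{\phi} : V_{\mathrm{Arch}} \to W$ with $\phi = \widetilde{\phi} \circ q$. In addition, this property characterizes $V_{\mathrm{Arch}}$: if $V'$ is any ordered $*$-vector space with an Archimedean order unit and $q' : V \to V'$ is a unital surjective positive linear map such that for every ordered $*$-vector space $(W,W^+)$ with Archimedean order unit and every unital positive linear map $\phi:V\to W$ there is a unique positive linear map $\phi':V'\to W$ with $\phi=\phi'\circ q'$, then $V'$ is isomorphic to $V_{\mathrm{Arch}}$ via a unital order isomorphism $\psi : V_{\mathrm{Arch}} \to V'$ with $\psi \circ q = q'$.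
   Context: A $*$-vector space is a complex vector space $V$ with a conjugate-linear involution $*:V\to V$; $V_h:=\{x\in V: x^*=x\}$ is the real subspace of hermitian elements. An ordered $*$-vector space $(V,V^+)$ is a $*$-vector space $V$ with a nonempty subset $V^+\subseteq V_h$ closed under addition and under multiplication by scalars in $[0,\infty)$, such that $V^+\cap -V^+=\{0\}$. For $v,w\in V_h$ write $v\ge w$ if $v-w\in V^+$. An element $e\in V_h$ is an order unit if for every $x\in V_h$ there is a real $r>0$ with $re\ge x$; it is Archimedean if, in addition, whenever $x\in V_h$ and $re+x\ge0$ for all real $r>0$, then $x\ge 0$. A $\mathbb{C}$-linear map $\phi:V\to W$ between ordered $*$-vector spaces with order units $e,e'$ is positive if $\phi(V^+)\subseteq W^+$, unital if $\phi(e)=e'$, and an order isomorphism if it is bijective and $v\in V^+$ if and only if $\phi(v)\in W^+$. A state on $V$ is a $\mathbb{C}$-linear functional $f:V\to\mathbb{C}$ with $f(V^+)\subseteq[0,\infty)$ and $f(e)=1$. Archimedeanization: let $D := \{ v \in V_h : re + v \in V^+ \text{ for all } r > 0 \}$ and $N := \bigcap_{f} \ker f$, the intersection over all states $f:V\to\mathbb{C}$ (equivalently $N=N_{\mathbb R}\oplus iN_{\mathbb R}$ with $N_{\mathbb R}=D\cap -D$). $N$ is a complex subspace closed under $*$. Then $V_{\mathrm{Arch}}$ is $V/N$ with $(v+N)^*=v^*+N$, positive cone $(V/N)^+:=\{v+N: v\in D\}$ and order unit $e+N$; it is an ordered $*$-vector space with Archimedean order unit $e+N$. *)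

theory Defs
  imports Complex_Main "HOL-Algebra.AbelCoset" "HOL-Algebra.Module"
begin

text \<open>
  Vector spaces are modules of HOL-Algebra over the field of complex numbers. The ring components
  \<^const>\<open>mult\<close> and \<^const>\<open>one\<close>, which the record of a module inherits, carry no meaning.
\<close>

definition complex_field :: "complex ring"
  where "complex_field = \<lparr>carrier = UNIV, mult = (*), one = 1, zero = 0, add = (+)\<rparr>"

record 'v ostar = "(complex, 'v) module" +
  star :: "'v \<Rightarrow> 'v"
  cone :: "'v set"

definition hermitian :: "'v ostar \<Rightarrow> 'v set"
  where "hermitian V = {x \<in> carrier V. star V x = x}"

locale star_vector_space = module complex_field V for V :: "'v ostar" (structure) +
  assumes star_closed: "x \<in> carrier V \<Longrightarrow> star V x \<in> carrier V"
    and star_star: "x \<in> carrier V \<Longrightarrow> star V (star V x) = x"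
    and star_add: "x \<in> carrier V \<Longrightarrow> y \<in> carrier V \<Longrightarrow> star V (x \<oplus> y) = star V x \<oplus> star V y"
    and star_smult: "x \<in> carrier V \<Longrightarrow> star V (c \<odot> x) = cnj c \<odot> star V x"

locale ordered_star_space = star_vector_space +
  assumes cone_nonempty: "cone V \<noteq> {}"
    and cone_hermitian: "cone V \<subseteq> hermitian V"
    and cone_add: "x \<in> cone V \<Longrightarrow> y \<in> cone V \<Longrightarrow> x \<oplus> y \<in> cone V"
    and cone_smult: "x \<in> cone V \<Longrightarrow> 0 \<le> r \<Longrightarrow> complex_of_real r \<odot> x \<in> cone V"
    and cone_proper: "cone V \<inter> a_inv V ` cone V = {\<zero>}"

definition order_unit :: "'v ostar \<Rightarrow> 'v \<Rightarrow> bool"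
  where "order_unit V e \<longleftrightarrow> e \<in> hermitian V \<and>
    (\<forall>x\<in>hermitian V. \<exists>r>0. (complex_of_real r \<odot>\<^bsub>V\<^esub> e) \<ominus>\<^bsub>V\<^esub> x \<in> cone V)"

definition archimedean_order_unit :: "'v ostar \<Rightarrow> 'v \<Rightarrow> bool"
  where "archimedean_order_unit V e \<longleftrightarrow> order_unit V e \<and>
    (\<forall>x\<in>hermitian V. (\<forall>r>0. (complex_of_real r \<odot>\<^bsub>V\<^esub> e) \<oplus>\<^bsub>V\<^esub> x \<in> cone V) \<longrightarrow> x \<in> cone V)"

text \<open>
  A map between carriers is represented by the function that is \<^const>\<open>undefined\<close> outside of
  its domain, so that equality of maps is equality of functions.
\<close>

definition linear_maps :: "'v ostar \<Rightarrow> 'w ostar \<Rightarrow> ('v \<Rightarrow> 'w) set"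
  where "linear_maps V W = {f \<in> carrier V \<rightarrow>\<^sub>E carrier W.
    (\<forall>x\<in>carrier V. \<forall>y\<in>carrier V. f (x \<oplus>\<^bsub>V\<^esub> y) = f x \<oplus>\<^bsub>W\<^esub> f y) \<and>
    (\<forall>c. \<forall>x\<in>carrier V. f (c \<odot>\<^bsub>V\<^esub> x) = c \<odot>\<^bsub>W\<^esub> f x)}"

definition positive_maps :: "'v ostar \<Rightarrow> 'w ostar \<Rightarrow> ('v \<Rightarrow> 'w) set"
  where "positive_maps V W = {f \<in> linear_maps V W. f ` cone V \<subseteq> cone W}"

definition order_isomorphisms :: "'v ostar \<Rightarrow> 'w ostar \<Rightarrow> ('v \<Rightarrow> 'w) set"
  where "order_isomorphisms V W = {f \<in> linear_maps V W.
    bij_betw f (carrier V) (carrier W) \<and> (\<forall>v\<in>carrier V. v \<in> cone V \<longleftrightarrow> f v \<in> cone W)}"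

definition complex_space :: "complex ostar"
  where "complex_space = \<lparr>carrier = UNIV, mult = (*), one = 1, zero = 0, add = (+),
    smult = (*), star = cnj, cone = complex_of_real ` {0..}\<rparr>"

definition states :: "'v ostar \<Rightarrow> 'v \<Rightarrow> ('v \<Rightarrow> complex) set"
  where "states V e = {f \<in> positive_maps V complex_space. f e = 1}"

definition arch_D :: "'v ostar \<Rightarrow> 'v \<Rightarrow> 'v set"
  where "arch_D V e =
    {v \<in> hermitian V. \<forall>r>0. (complex_of_real r \<odot>\<^bsub>V\<^esub> e) \<oplus>\<^bsub>V\<^esub> v \<in> cone V}"

definition arch_N :: "'v ostar \<Rightarrow> 'v \<Rightarrow> 'v set"
  where "arch_N V e = {v \<in> carrier V. \<forall>f\<in>states V e. f v = 0}"

text \<open>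
  Elements of the quotient are the cosets \<open>N +> v\<close>. The image of \<open>N +> v\<close> under the involution is
  the coset of the involution of \<open>v\<close>, because \<open>N\<close> is closed under the involution. In the scalar
  multiplication, \<open>N\<close> is added to the pointwise multiple so that the result is a full coset also
  for the scalar 0.
\<close>

definition archimedeanization :: "'v ostar \<Rightarrow> 'v \<Rightarrow> 'v set ostar"
  where "archimedeanization V e = (let N = arch_N V e in
    \<lparr>carrier = a_rcosets\<^bsub>V\<^esub> N,
     mult = undefined, one = undefined,
     zero = N,
     add = set_add V,
     smult = (\<lambda>c X. N <+>\<^bsub>V\<^esub> ((\<lambda>x. c \<odot>\<^bsub>V\<^esub> x) ` X)),
     star = (\<lambda>X. star V ` X),
     cone = {N +>\<^bsub>V\<^esub> v | v. v \<in> arch_D V e}\<rparr>)"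

definition arch_unit :: "'v ostar \<Rightarrow> 'v \<Rightarrow> 'v set"
  where "arch_unit V e = arch_N V e +>\<^bsub>V\<^esub> e"

lemma cring_complex_field: "cring complex_field"
  by (rule cringI, rule abelian_groupI, rule_tac [7] comm_monoidI)
     (auto simp: complex_field_def algebra_simps intro: exI[of _ "- _"])

lemma ordered_star_space_complex_space: "ordered_star_space complex_space"
proof -
  have ab: "abelian_group complex_space"
    by (rule abelian_groupI) (auto simp: complex_space_def algebra_simps intro: exI[of _ "- _"])
  have "module complex_field complex_space"
    by (rule moduleI[OF cring_complex_field ab])
       (auto simp: complex_field_def complex_space_def algebra_simps)
  then show ?thesis
    unfolding ordered_star_space_def star_vector_space_def
  proof (intro conjI)
    show "star_vector_space_axioms complex_space"
      by unfold_locales (auto simp: complex_space_def)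
    have inv: "\<ominus>\<^bsub>complex_space\<^esub> x = - x" for x
      by (rule abelian_group.minus_equality[OF ab]) (auto simp: complex_space_def)
    show "ordered_star_space_axioms complex_space"
    proof
      show "cone complex_space \<inter> a_inv complex_space ` cone complex_space = {\<zero>\<^bsub>complex_space\<^esub>}"
        unfolding inv by (auto simp: complex_space_def image_iff complex_eq_iff intro!: bexI[of _ 0])
    qed (auto simp: complex_space_def hermitian_def image_iff complex_eq_iff intro!: bexI[of _ "_ + _"] bexI[of _ "_ * _"])
  qed
qed

end

theory Submission
  imports Defs
begin

text \<open>
  Every part of the statement rests on one fact: a hermitian element \<open>v\<close> belongs to \<open>D\<close> if and only
  if every state is nonnegative at \<open>v\<close> (\<open>arch_D_iff_states\<close>). One direction is immediate. The other
  one is a Hahn-Banach separation (\<open>state_separating\<close>): if \<open>re + v\<close> is not positive for some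
  \<open>r > 0\<close>, then some state is negative at \<open>v\<close>. It is proved here with cones in place of functionals.
  The cone generated by \<open>V\<^sup>+\<close> and \<open>-(re + v)\<close> does not contain \<open>-e\<close>. By Zorn's lemma it lies in a
  maximal cone \<open>C\<close> without \<open>-e\<close>, and maximality forces \<open>C \<union> -C = V\<^sub>h\<close>. For such a total cone the
  function \<open>g x = sup {t. x - te \<in> C}\<close> is real linear, nonnegative on \<open>C\<close>, and \<open>g e = 1\<close>. Its
  complexification is a state, and it is negative at \<open>v\<close> because \<open>-(re + v)\<close> lies in \<open>C\<close>.

  Since \<open>N\<close> is the common kernel of the states, the coset of \<open>x\<close> consists of the elements at which
  all states take the same values as at \<open>x\<close>. With the fact above, a coset is hermitian (positive) in
  the quotient if and only if all states are real (real and nonnegative) on it. The axioms of an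
  ordered space and the Archimedean property of the quotient thereby become statements about
  complex numbers.

  For the universal property, a unital positive map \<open>\<phi>\<close> into an Archimedean space sends \<open>D\<close> to
  positive elements, because it preserves the inequalities \<open>re + v \<ge> 0\<close>. If \<open>v\<close> is a hermitian
  element of \<open>N\<close>, then \<open>v\<close> and \<open>-v\<close> are in \<open>D\<close>, so \<open>\<phi> v\<close> and \<open>-\<phi> v\<close> are positive and \<open>\<phi> v = 0\<close>. Hence
  \<open>\<phi>\<close> vanishes on \<open>N\<close> and factors through the quotient (\<open>positive_map_factors_uniquely\<close>). Finally,
  the universal properties of \<open>q\<close> and \<open>q'\<close> yield positive maps in both directions, and these are mutually inverse because \<open>q\<close> and \<open>q'\<close> are surjective.
\<close>

section \<open>Linear algebra in a star-vector space\<close>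

lemma complex_field_simps [simp]:
  "carrier complex_field = UNIV" "\<zero>\<^bsub>complex_field\<^esub> = 0" "\<one>\<^bsub>complex_field\<^esub> = 1"
  "x \<oplus>\<^bsub>complex_field\<^esub> y = x + y" "x \<otimes>\<^bsub>complex_field\<^esub> y = x * y"
  by (simp_all add: complex_field_def)

lemma complex_space_simps [simp]:
  "carrier complex_space = UNIV" "\<zero>\<^bsub>complex_space\<^esub> = 0"
  "x \<oplus>\<^bsub>complex_space\<^esub> y = x + y" "c \<odot>\<^bsub>complex_space\<^esub> x = c * x"
  "cone complex_space = complex_of_real ` {0..}"
  by (simp_all add: complex_space_def)

lemma in_nonneg_reals_iff: "z \<in> complex_of_real ` {0..} \<longleftrightarrow> Im z = 0 \<and> 0 \<le> Re z"
  by (auto simp: image_iff complex_eq_iff)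

context star_vector_space
begin

lemma smult_in_carrier [simp, intro]: "x \<in> carrier V \<Longrightarrow> c \<odot> x \<in> carrier V"
  using smult_closed by simp

lemma smult_add_right: "x \<in> carrier V \<Longrightarrow> y \<in> carrier V \<Longrightarrow> c \<odot> (x \<oplus> y) = c \<odot> x \<oplus> c \<odot> y"
  using smult_r_distr by simp

lemma smult_smult: "x \<in> carrier V \<Longrightarrow> c \<odot> (d \<odot> x) = (c * d) \<odot> x"
  using smult_assoc1[of c d x] by simp

lemma one_smult [simp]: "x \<in> carrier V \<Longrightarrow> 1 \<odot> x = x"
  using smult_one by simp

lemma zero_smult [simp]: "x \<in> carrier V \<Longrightarrow> 0 \<odot> x = \<zero>"
  using smult_l_null by simp

lemma smult_zero [simp]: "c \<odot> \<zero> = \<zero>"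
  using smult_r_null by simp

lemma smult_combine: "x \<in> carrier V \<Longrightarrow> c \<odot> x \<oplus> d \<odot> x = (c + d) \<odot> x"
  using smult_l_distr[of c d x] by simp

lemma minus_smult: "x \<in> carrier V \<Longrightarrow> \<ominus> x = (- 1) \<odot> x"
proof -
  assume x: "x \<in> carrier V"
  have "(- 1) \<odot> x \<oplus> 1 \<odot> x = \<zero>"
    unfolding smult_combine[OF x] using x by simp
  then have "(- 1) \<odot> x \<oplus> x = \<zero>"
    using x by simp
  then show ?thesis
    using x by (intro minus_equality) auto
qed

text \<open>
  The variants of \<open>smult_combine\<close> for a coefficient 1 that is not written, and for summands inside
  a longer sum associated to the right.
\<close>

lemma smult_combine_more:
  assumes "x \<in> carrier V"
  shows "x \<oplus> d \<odot> x = (1 + d) \<odot> x" "c \<odot> x \<oplus> x = (c + 1) \<odot> x" "x \<oplus> x = 2 \<odot> x"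
    and "y \<in> carrier V \<Longrightarrow> c \<odot> x \<oplus> (d \<odot> x \<oplus> y) = (c + d) \<odot> x \<oplus> y"
    and "y \<in> carrier V \<Longrightarrow> x \<oplus> (d \<odot> x \<oplus> y) = (1 + d) \<odot> x \<oplus> y"
    and "y \<in> carrier V \<Longrightarrow> c \<odot> x \<oplus> (x \<oplus> y) = (c + 1) \<odot> x \<oplus> y"
    and "y \<in> carrier V \<Longrightarrow> x \<oplus> (x \<oplus> y) = 2 \<odot> x \<oplus> y"
proof -
  show *: "x \<oplus> d \<odot> x = (1 + d) \<odot> x" "c \<odot> x \<oplus> x = (c + 1) \<odot> x" "x \<oplus> x = 2 \<odot> x"
    using assms smult_combine[of x 1 d] smult_combine[of x c 1] smult_combine[of x 1 1] by simp_all
  assume "y \<in> carrier V"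
  then show "c \<odot> x \<oplus> (d \<odot> x \<oplus> y) = (c + d) \<odot> x \<oplus> y"
    "x \<oplus> (d \<odot> x \<oplus> y) = (1 + d) \<odot> x \<oplus> y"
    "c \<odot> x \<oplus> (x \<oplus> y) = (c + 1) \<odot> x \<oplus> y"
    "x \<oplus> (x \<oplus> y) = 2 \<odot> x \<oplus> y"
    using assms by (simp_all add: * smult_combine flip: a_assoc)
qed

text \<open>
  Rewriting with these rules multiplies out scalars and merges multiples of the same vector.
\<close>

lemmas lincomb =
  a_minus_def minus_smult smult_add_right smult_smult smult_combine smult_combine_more a_ac

lemma smult_divide_cancel:
  assumes "x \<in> carrier V" "r \<noteq> 0"
  shows "complex_of_real (1 / r) \<odot> (complex_of_real r \<odot> x) = x"
  using assms by (simp add: smult_smult)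

lemma hermitian_carrier: "x \<in> hermitian V \<Longrightarrow> x \<in> carrier V"
  by (simp add: hermitian_def)

lemma star_zero [simp]: "star V \<zero> = \<zero>"
  using star_smult[of \<zero> 0] star_closed[of \<zero>] by simp

lemma hermitian_zero: "\<zero> \<in> hermitian V"
  by (simp add: hermitian_def)

lemma hermitian_add: "x \<in> hermitian V \<Longrightarrow> y \<in> hermitian V \<Longrightarrow> x \<oplus> y \<in> hermitian V"
  by (simp add: hermitian_def star_add)

lemma hermitian_smult: "x \<in> hermitian V \<Longrightarrow> complex_of_real r \<odot> x \<in> hermitian V"
  by (simp add: hermitian_def star_smult)

lemma hermitian_minus: "x \<in> hermitian V \<Longrightarrow> \<ominus> x \<in> hermitian V"
  using hermitian_smult[of x "- 1"] by (simp add: minus_smult hermitian_carrier)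

text \<open>
  The hermitian part \<open>(x + x\<^sup>*) / 2\<close>, the analogue of the real part of a complex number. The
  imaginary part is the hermitian part of \<open>-ix\<close>.
\<close>

definition hermitian_part :: "'v \<Rightarrow> 'v"
  where "hermitian_part x = (1 / 2) \<odot> (x \<oplus> star V x)"

lemma hermitian_part_hermitian: "x \<in> carrier V \<Longrightarrow> hermitian_part x \<in> hermitian V"
  by (simp add: hermitian_part_def hermitian_def star_add star_smult star_closed star_star a_comm)

lemma hermitian_part_carrier [simp]: "x \<in> carrier V \<Longrightarrow> hermitian_part x \<in> carrier V"
  by (simp add: hermitian_part_hermitian hermitian_carrier)

lemma hermitian_part_ident: "x \<in> hermitian V \<Longrightarrow> hermitian_part x = x"
  by (simp add: hermitian_part_def hermitian_def lincomb)

lemma hermitian_part_add: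
  "x \<in> carrier V \<Longrightarrow> y \<in> carrier V \<Longrightarrow> hermitian_part (x \<oplus> y) = hermitian_part x \<oplus> hermitian_part y"
  by (simp add: hermitian_part_def star_add star_closed lincomb)

lemma hermitian_part_smult:
  "x \<in> carrier V \<Longrightarrow>
    hermitian_part (complex_of_real r \<odot> x) = complex_of_real r \<odot> hermitian_part x"
  by (simp add: hermitian_part_def star_smult star_closed lincomb mult.commute)

lemma hermitian_part_ii: "x \<in> hermitian V \<Longrightarrow> hermitian_part (\<i> \<odot> x) = \<zero>"
  by (simp add: hermitian_part_def hermitian_def star_smult lincomb)

lemma hermitian_decomposition:
  "x \<in> carrier V \<Longrightarrow> x = hermitian_part x \<oplus> \<i> \<odot> hermitian_part ((- \<i>) \<odot> x)"
  by (simp add: hermitian_part_def star_smult star_closed lincomb)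

text \<open>
  A real-linear functional on \<open>V\<^sub>h\<close>, given as a function on all of \<open>V\<close> whose values outside of
  \<open>V\<^sub>h\<close> are irrelevant, extends to a complex-linear functional on \<open>V\<close>.
\<close>

lemma complexify_functional:
  fixes g :: "'v \<Rightarrow> real"
  assumes add: "\<And>x y. x \<in> hermitian V \<Longrightarrow> y \<in> hermitian V \<Longrightarrow> g (x \<oplus> y) = g x + g y"
    and smult: "\<And>r x. x \<in> hermitian V \<Longrightarrow> g (complex_of_real r \<odot> x) = r * g x"
  obtains f where "f \<in> linear_maps V complex_space"
    and "\<And>x. x \<in> hermitian V \<Longrightarrow> f x = complex_of_real (g x)"
proof
  \<comment> \<open>\<open>h\<close> will be the real part of \<open>f\<close>; a complex-linear functional is determined by its real part.\<close>
  define h where "h x = complex_of_real (g (hermitian_part x))" for x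
  define f where "f = (\<lambda>x\<in>carrier V. h x - \<i> * h (\<i> \<odot> x))"
  have h_add: "h (x \<oplus> y) = h x + h y" if "x \<in> carrier V" "y \<in> carrier V" for x y
    using that by (simp add: h_def hermitian_part_add add hermitian_part_hermitian)
  have h_smult: "h (complex_of_real r \<odot> x) = complex_of_real r * h x" if "x \<in> carrier V" for r x
    using that by (simp add: h_def hermitian_part_smult smult hermitian_part_hermitian)
  have g0: "g \<zero> = 0"
    using smult[OF hermitian_zero, of 0] by simp
  have f_smult: "f (c \<odot> x) = c * f x" if x: "x \<in> carrier V" for c x
  proof -
    have *: "h (c \<odot> y) = complex_of_real (Re c) * h y + complex_of_real (Im c) * h (\<i> \<odot> y)"
      if y: "y \<in> carrier V" for c y
    proof -
      have "c \<odot> y = complex_of_real (Re c) \<odot> y \<oplus> complex_of_real (Im c) \<odot> (\<i> \<odot> y)"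
        using y by (subst complex_eq) (simp add: lincomb mult.commute)
      then show ?thesis
        using y by (simp add: h_add h_smult)
    qed
    have eqs: "f (c \<odot> x) = h (c \<odot> x) - \<i> * h ((\<i> * c) \<odot> x)" "f x = h x - \<i> * h (\<i> \<odot> x)"
      using x by (simp_all add: f_def smult_smult)
    show ?thesis
      unfolding eqs *[OF x, of c] *[OF x, of "\<i> * c"]
      by (simp add: complex_eq_iff algebra_simps)
  qed
  show "f \<in> linear_maps V complex_space"
    unfolding linear_maps_def using f_smult
    by (auto simp: f_def h_add smult_add_right algebra_simps)
  show "f x = complex_of_real (g x)" if "x \<in> hermitian V" for x
    using that by (simp add: f_def h_def hermitian_carrier hermitian_part_ident hermitian_part_ii g0)
qed

end

section \<open>Separation by states\<close>

context ordered_star_space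
begin

lemma cone_imp_hermitian: "x \<in> cone V \<Longrightarrow> x \<in> hermitian V"
  using cone_hermitian by blast

lemma cone_imp_carrier: "x \<in> cone V \<Longrightarrow> x \<in> carrier V"
  by (simp add: cone_imp_hermitian hermitian_carrier)

lemma zero_in_cone: "\<zero> \<in> cone V"
  using cone_proper by blast

lemma cone_antisym: "x \<in> cone V \<Longrightarrow> \<ominus> x \<in> cone V \<Longrightarrow> x = \<zero>"
  using cone_proper cone_imp_carrier[of x] minus_minus[of x] by (metis IntI imageI singletonD)

end

text \<open>
  An ordered star-vector space with an order unit \<open>e\<close>, which need not be Archimedean.
\<close>

locale order_unit_space = ordered_star_space V
  for V :: "'v ostar" (structure) and e :: 'v +
  assumes order_unit: "order_unit V e"
begin

lemma unit_hermitian: "e \<in> hermitian V"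
  using order_unit by (simp add: order_unit_def)

lemma unit_carrier [simp]: "e \<in> carrier V"
  by (simp add: unit_hermitian hermitian_carrier)

lemma unit_dominates:
  assumes "x \<in> hermitian V"
  obtains r where "r > 0" "complex_of_real r \<odot> e \<ominus> x \<in> cone V"
  using order_unit assms by (auto simp: order_unit_def)

lemma unit_in_cone: "e \<in> cone V"
proof -
  obtain r where r: "r > 0" "complex_of_real r \<odot> e \<ominus> \<zero> \<in> cone V"
    using unit_dominates[OF hermitian_zero] by blast
  then have "complex_of_real r \<odot> e \<in> cone V"
    by (simp add: lincomb)
  then have "complex_of_real (1 / r) \<odot> (complex_of_real r \<odot> e) \<in> cone V"
    by (rule cone_smult) (use r in simp)
  then show ?thesis
    using r by (simp only: smult_divide_cancel[OF unit_carrier, of r])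
qed

text \<open>
  The zero space has an order unit but no states. It is the only case where \<open>-e\<close> is positive.
\<close>

lemma trivial_if_minus_unit_in_cone:
  assumes "\<ominus> e \<in> cone V" "x \<in> hermitian V"
  shows "x = \<zero>"
proof -
  have e: "e = \<zero>"
    using assms(1) unit_in_cone by (rule cone_antisym[rotated])
  have *: "\<ominus> y \<in> cone V" if y: "y \<in> hermitian V" for y
  proof -
    obtain r where "r > 0" "complex_of_real r \<odot> e \<ominus> y \<in> cone V"
      using unit_dominates[OF y] by blast
    then show ?thesis
      using y by (simp add: e a_minus_def hermitian_carrier)
  qed
  show ?thesis
    using *[OF assms(2)] *[OF hermitian_minus[OF assms(2)]] assms(2)
    by (intro cone_antisym) (simp_all add: hermitian_carrier)
qed

text \<open>
  The cones of hermitian elements that contain \<open>V\<^sup>+\<close> but not \<open>-e\<close>. They need not be proper, so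
  \<open>C \<inter> -C\<close> may be large.
\<close>

definition extension_cones :: "'v set set"
  where "extension_cones = {C. cone V \<subseteq> C \<and> C \<subseteq> hermitian V \<and> \<ominus> e \<notin> C \<and>
    (\<forall>x\<in>C. \<forall>y\<in>C. x \<oplus> y \<in> C) \<and> (\<forall>x\<in>C. \<forall>r\<ge>0. complex_of_real r \<odot> x \<in> C)}"

lemma adjoin_to_extension_cone:
  assumes "cone V \<subseteq> C" "C \<subseteq> hermitian V" "y \<in> hermitian V"
    and add: "\<And>x y. x \<in> C \<Longrightarrow> y \<in> C \<Longrightarrow> x \<oplus> y \<in> C"
    and smult: "\<And>x r. x \<in> C \<Longrightarrow> r \<ge> 0 \<Longrightarrow> complex_of_real r \<odot> x \<in> C"
    and proper: "\<And>c s. c \<in> C \<Longrightarrow> s \<ge> 0 \<Longrightarrow> c \<oplus> complex_of_real s \<odot> y \<noteq> \<ominus> e"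
  obtains D where "D \<in> extension_cones" "C \<subseteq> D" "y \<in> D"
proof
  define D where "D = {c \<oplus> complex_of_real s \<odot> y | c s. c \<in> C \<and> s \<ge> 0}"
  note y = hermitian_carrier[OF assms(3)]
  have C: "c \<in> carrier V" if "c \<in> C" for c
    using that assms(2) hermitian_carrier by blast
  show sub: "C \<subseteq> D"
  proof
    fix c assume "c \<in> C"
    then have "c = c \<oplus> complex_of_real 0 \<odot> y"
      using y C by simp
    then show "c \<in> D"
      unfolding D_def using \<open>c \<in> C\<close> by force
  qed
  have "y = \<zero> \<oplus> complex_of_real 1 \<odot> y"
    using y by simp
  then show "y \<in> D"
    unfolding D_def using zero_in_cone assms(1) by (smt (verit) mem_Collect_eq subsetD)
  have "D \<subseteq> hermitian V"
    unfolding D_def using assms(2,3) by (auto intro!: hermitian_add hermitian_smult)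
  moreover have "\<ominus> e \<notin> D"
    unfolding D_def using proper by (smt (verit) mem_Collect_eq)
  moreover have "x \<oplus> z \<in> D" if "x \<in> D" "z \<in> D" for x z
  proof -
    obtain c s d t where "c \<in> C" "d \<in> C" "s \<ge> 0" "t \<ge> 0"
      "x = c \<oplus> complex_of_real s \<odot> y" "z = d \<oplus> complex_of_real t \<odot> y"
      using \<open>x \<in> D\<close> \<open>z \<in> D\<close> unfolding D_def by blast
    then have "x \<oplus> z = (c \<oplus> d) \<oplus> complex_of_real (s + t) \<odot> y" "c \<oplus> d \<in> C" "s + t \<ge> 0"
      using C y add by (simp_all add: lincomb)
    then show ?thesis
      unfolding D_def by blast
  qed
  moreover have "complex_of_real r \<odot> x \<in> D" if "x \<in> D" "r \<ge> 0" for x r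
  proof -
    obtain c s where "c \<in> C" "s \<ge> 0" "x = c \<oplus> complex_of_real s \<odot> y"
      using \<open>x \<in> D\<close> unfolding D_def by blast
    then have "complex_of_real r \<odot> x = complex_of_real r \<odot> c \<oplus> complex_of_real (r * s) \<odot> y"
      "complex_of_real r \<odot> c \<in> C" "r * s \<ge> 0"
      using C y smult \<open>r \<ge> 0\<close> by (simp_all add: lincomb)
    then show ?thesis
      unfolding D_def by blast
  qed
  ultimately show "D \<in> extension_cones"
    unfolding extension_cones_def using sub assms(1) by blast
qed

lemma maximal_extension_cone_total:
  assumes C: "C \<in> extension_cones" and max: "\<And>D. D \<in> extension_cones \<Longrightarrow> C \<subseteq> D \<Longrightarrow> D = C"
    and x: "x \<in> hermitian V"
  shows "x \<in> C \<or> \<ominus> x \<in> C"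
proof (rule ccontr)
  assume not: "\<not> (x \<in> C \<or> \<ominus> x \<in> C)"
  have carr: "c \<in> carrier V" if "c \<in> C" for c
    using that C hermitian_carrier unfolding extension_cones_def by blast
  have ex: "\<exists>c\<in>C. \<exists>s\<ge>0. c \<oplus> complex_of_real s \<odot> y = \<ominus> e"
    if y: "y \<in> hermitian V" "y \<notin> C" for y
  proof (rule ccontr)
    assume *: "\<not> (\<exists>c\<in>C. \<exists>s\<ge>0. c \<oplus> complex_of_real s \<odot> y = \<ominus> e)"
    obtain D where "D \<in> extension_cones" "C \<subseteq> D" "y \<in> D"
    proof (rule adjoin_to_extension_cone[of C y])
      show "c \<oplus> complex_of_real s \<odot> y \<noteq> \<ominus> e" if "c \<in> C" "s \<ge> 0" for c s
        using * that by blast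
    qed (use C y in \<open>auto simp: extension_cones_def\<close>)
    with max y show False
      by blast
  qed
  \<comment> \<open>Both \<open>x\<close> and \<open>-x\<close>, when adjoined, produce \<open>-e\<close>; a combination that cancels \<open>x\<close> puts \<open>-e\<close> into \<open>C\<close>.\<close>
  obtain c s where c: "c \<in> C" "s \<ge> 0" "c \<oplus> complex_of_real s \<odot> x = \<ominus> e"
    using ex[OF x] not by blast
  obtain d t where d: "d \<in> C" "t \<ge> 0" "d \<oplus> complex_of_real t \<odot> (\<ominus> x) = \<ominus> e"
    using ex[OF hermitian_minus[OF x]] not by blast
  have s: "s > 0"
  proof (rule ccontr)
    assume "\<not> s > 0"
    with c have "c = \<ominus> e"
      using carr x by (simp add: hermitian_carrier)
    with c C show False
      by (simp add: extension_cones_def)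
  qed
  have "complex_of_real t \<odot> c \<oplus> complex_of_real s \<odot> d =
    complex_of_real t \<odot> (c \<oplus> complex_of_real s \<odot> x)
      \<oplus> complex_of_real s \<odot> (d \<oplus> complex_of_real t \<odot> (\<ominus> x))"
    using carr c(1) d(1) hermitian_carrier[OF x] by (simp add: lincomb)
  also have "\<dots> = complex_of_real (s + t) \<odot> (\<ominus> e)"
    unfolding c(3) d(3) by (simp add: lincomb)
  finally have "complex_of_real (s + t) \<odot> (\<ominus> e)
      = complex_of_real t \<odot> c \<oplus> complex_of_real s \<odot> d" ..
  moreover have "complex_of_real t \<odot> c \<oplus> complex_of_real s \<odot> d \<in> C"
    using C c d by (auto simp: extension_cones_def)
  ultimately have "complex_of_real (s + t) \<odot> (\<ominus> e) \<in> C"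
    by (simp only:)
  moreover have "complex_of_real (1 / (s + t)) \<odot> x \<in> C" if "x \<in> C" for x
    using that C s d(2) unfolding extension_cones_def by (auto simp del: of_real_divide of_real_add)
  ultimately have "complex_of_real (1 / (s + t)) \<odot> (complex_of_real (s + t) \<odot> (\<ominus> e)) \<in> C"
    by blast
  then show False
    using C s d(2) smult_divide_cancel[of "\<ominus> e" "s + t"]
    by (simp add: extension_cones_def del: of_real_divide of_real_add)
qed

lemma extension_cone_contains_total:
  assumes "C0 \<in> extension_cones"
  obtains C where "C \<in> extension_cones" "C0 \<subseteq> C"
    and "\<And>x. x \<in> hermitian V \<Longrightarrow> x \<in> C \<or> \<ominus> x \<in> C"
proof -
  define \<A> where "\<A> = {C \<in> extension_cones. C0 \<subseteq> C}"
  have "\<Union>\<C> \<in> \<A>" if ne: "\<C> \<noteq> {}" and chain: "subset.chain \<A> \<C>" for \<C>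
  proof -
    have \<C>: "C \<in> extension_cones" "C0 \<subseteq> C" if "C \<in> \<C>" for C
      using that chain by (auto simp: subset.chain_def \<A>_def)
    have "x \<oplus> y \<in> \<Union>\<C>" if xy: "x \<in> \<Union>\<C>" "y \<in> \<Union>\<C>" for x y
    proof -
      obtain C D where "C \<in> \<C>" "D \<in> \<C>" "x \<in> C" "y \<in> D"
        using xy by blast
      moreover have "C \<subseteq> D \<or> D \<subseteq> C"
        using chain \<open>C \<in> \<C>\<close> \<open>D \<in> \<C>\<close> by (auto simp: subset.chain_def)
      ultimately obtain E where "E \<in> \<C>" "x \<in> E" "y \<in> E"
        by blast
      then have "x \<oplus> y \<in> E"
        using \<C>(1)[of E] by (auto simp: extension_cones_def)
      then show ?thesis
        using \<open>E \<in> \<C>\<close> by blast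
    qed
    moreover have "complex_of_real r \<odot> x \<in> \<Union>\<C>" if x: "x \<in> \<Union>\<C>" "r \<ge> 0" for x r
    proof -
      obtain C where "C \<in> \<C>" "x \<in> C"
        using x by blast
      then have "complex_of_real r \<odot> x \<in> C"
        using \<C>(1)[of C] x(2) by (auto simp: extension_cones_def)
      then show ?thesis
        using \<open>C \<in> \<C>\<close> by blast
    qed
    moreover have "cone V \<subseteq> \<Union>\<C>" "\<Union>\<C> \<subseteq> hermitian V" "\<ominus> e \<notin> \<Union>\<C>"
      using \<C>(1) ne by (force simp: extension_cones_def)+
    moreover have "C0 \<subseteq> \<Union>\<C>"
      using \<C>(2) ne by blast
    ultimately show ?thesis
      by (simp add: \<A>_def extension_cones_def)
  qed
  moreover have "\<A> \<noteq> {}"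
    using assms by (auto simp: \<A>_def)
  ultimately obtain C where C: "C \<in> \<A>" "\<And>D. D \<in> \<A> \<Longrightarrow> C \<subseteq> D \<Longrightarrow> D = C"
    using subset_Zorn_nonempty[of \<A>] by blast
  show thesis
  proof
    show "x \<in> C \<or> \<ominus> x \<in> C" if "x \<in> hermitian V" for x
    proof (rule maximal_extension_cone_total[OF _ _ that])
      show "D = C" if "D \<in> extension_cones" "C \<subseteq> D" for D
        using C that by (auto simp: \<A>_def)
    qed (use C in \<open>simp add: \<A>_def\<close>)
  qed (use C in \<open>auto simp: \<A>_def\<close>)
qed

text \<open>
  A total cone \<open>C\<close> defines a total preorder on \<open>V\<^sub>h\<close>, and \<open>g x\<close> is the real number at which
  the multiples of \<open>e\<close> pass \<open>x\<close>. The definition as a supremum makes \<open>g\<close> superadditive; since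
  totality gives \<open>g (-x) = -g x\<close>, it is additive.
\<close>

lemma total_extension_cone_functional:
  assumes C: "C \<in> extension_cones"
    and total: "\<And>x. x \<in> hermitian V \<Longrightarrow> x \<in> C \<or> \<ominus> x \<in> C"
  obtains g :: "'v \<Rightarrow> real" where
    "\<And>x y. x \<in> hermitian V \<Longrightarrow> y \<in> hermitian V \<Longrightarrow> g (x \<oplus> y) = g x + g y"
    and "\<And>r x. x \<in> hermitian V \<Longrightarrow> g (complex_of_real r \<odot> x) = r * g x"
    and "\<And>x. x \<in> C \<Longrightarrow> g x \<ge> 0" and "g e = 1"
proof -
  define T where "T x = {t. x \<oplus> complex_of_real (- t) \<odot> e \<in> C}" for x
  define g where "g x = Sup (T x)" for x
  note hc = hermitian_carrier
  have C_add: "x \<oplus> y \<in> C" if "x \<in> C" "y \<in> C" for x y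
    using C that by (simp add: extension_cones_def)
  have C_smult: "complex_of_real r \<odot> x \<in> C" if "x \<in> C" "r \<ge> 0" for r x
    using C that by (simp add: extension_cones_def)
  have cone_C: "x \<in> C" if "x \<in> cone V" for x
    using C that by (auto simp: extension_cones_def)
  have C_carrier: "x \<in> carrier V" if "x \<in> C" for x
    using C that by (auto simp: extension_cones_def hc)
  have unit_multiple: "r \<ge> 0" if "complex_of_real r \<odot> e \<in> C" for r
  proof (rule ccontr)
    assume "\<not> r \<ge> 0"
    then have "complex_of_real (1 / - r) \<odot> (complex_of_real r \<odot> e) \<in> C"
      by (intro C_smult that) simp
    moreover have "complex_of_real (1 / - r) \<odot> (complex_of_real r \<odot> e) = \<ominus> e"
      using \<open>\<not> r \<ge> 0\<close> by (simp add: lincomb)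
    ultimately show False
      using C by (simp add: extension_cones_def)
  qed
  have T_le: "t + s \<le> 0" if t: "t \<in> T x" and s: "s \<in> T (\<ominus> x)" and x: "x \<in> hermitian V" for x s t
  proof -
    have "complex_of_real (- (t + s)) \<odot> e
        = (x \<oplus> complex_of_real (- t) \<odot> e) \<oplus> (\<ominus> x \<oplus> complex_of_real (- s) \<odot> e)"
      using hc[OF x] by (simp add: lincomb algebra_simps)
    then have "complex_of_real (- (t + s)) \<odot> e \<in> C"
      using C_add[of "x \<oplus> complex_of_real (- t) \<odot> e" "\<ominus> x \<oplus> complex_of_real (- s) \<odot> e"] t s
      by (simp add: T_def)
    then show ?thesis
      using unit_multiple by fastforce
  qed
  have T_minus_nonempty: "T (\<ominus> x) \<noteq> {}" if x: "x \<in> hermitian V" for x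
  proof -
    obtain r where "complex_of_real r \<odot> e \<ominus> x \<in> cone V"
      using unit_dominates[OF x] by blast
    then have "- r \<in> T (\<ominus> x)"
      using hc[OF x] cone_C by (simp add: T_def a_minus_def a_comm)
    then show ?thesis
      by blast
  qed
  have T_nonempty: "T x \<noteq> {}" if x: "x \<in> hermitian V" for x
    using T_minus_nonempty[OF hermitian_minus[OF x]] x by (simp add: hc)
  have T_bdd: "bdd_above (T x)" if x: "x \<in> hermitian V" for x
  proof -
    obtain s where "s \<in> T (\<ominus> x)"
      using T_minus_nonempty[OF x] by blast
    then have "\<And>t. t \<in> T x \<Longrightarrow> t \<le> - s"
      using T_le[OF _ _ x] by fastforce
    then show ?thesis
      by (rule bdd_aboveI)
  qed
  have g_upper: "t \<le> g x" if "t \<in> T x" "x \<in> hermitian V" for t x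
    unfolding g_def using that T_bdd by (intro cSup_upper)
  have g_least: "g x \<le> b" if "\<And>t. t \<in> T x \<Longrightarrow> t \<le> b" "x \<in> hermitian V" for x b
    unfolding g_def using that T_nonempty by (intro cSup_least)
  have g_super: "g x + g y \<le> g (x \<oplus> y)" if x: "x \<in> hermitian V" and y: "y \<in> hermitian V" for x y
  proof -
    have *: "t + s \<le> g (x \<oplus> y)" if "t \<in> T x" "s \<in> T y" for t s
    proof (rule g_upper)
      have "(x \<oplus> y) \<oplus> complex_of_real (- (t + s)) \<odot> e
          = (x \<oplus> complex_of_real (- t) \<odot> e) \<oplus> (y \<oplus> complex_of_real (- s) \<odot> e)"
        using hc[OF x] hc[OF y] by (simp add: lincomb algebra_simps)
      then show "t + s \<in> T (x \<oplus> y)"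
        using that C_add unfolding T_def by simp
    qed (use x y in \<open>simp add: hermitian_add\<close>)
    have "g x \<le> g (x \<oplus> y) - s" if "s \<in> T y" for s
      using * that by (intro g_least x) (simp add: le_diff_eq)
    then have "g y \<le> g (x \<oplus> y) - g x"
      by (intro g_least y) (simp add: le_diff_eq add.commute)
    then show ?thesis
      by simp
  qed
  have g_minus: "g (\<ominus> x) = - g x" if x: "x \<in> hermitian V" for x
  proof (rule antisym)
    have *: "t \<le> - s" if "t \<in> T x" "s \<in> T (\<ominus> x)" for t s
      using T_le[OF that x] by simp
    have "g x \<le> - s" if "s \<in> T (\<ominus> x)" for s
      using * that by (intro g_least x)
    then show "g (\<ominus> x) \<le> - g x"
      by (intro g_least hermitian_minus x) (simp add: le_minus_iff)
    show "- g x \<le> g (\<ominus> x)"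
    proof (rule dense_ge)
      \<comment> \<open>Here totality of \<open>C\<close> enters: if \<open>-x - ze\<close> is not in \<open>C\<close>, then \<open>x + ze\<close> is.\<close>
      fix z assume z: "z > g (\<ominus> x)"
      then have "z \<notin> T (\<ominus> x)"
        using g_upper hermitian_minus[OF x] by fastforce
      moreover have "\<ominus> x \<oplus> complex_of_real (- z) \<odot> e \<in> hermitian V"
        by (intro hermitian_add hermitian_minus hermitian_smult x unit_hermitian)
      ultimately have "\<ominus> (\<ominus> x \<oplus> complex_of_real (- z) \<odot> e) \<in> C"
        using total by (auto simp: T_def)
      also have "\<ominus> (\<ominus> x \<oplus> complex_of_real (- z) \<odot> e) = x \<oplus> complex_of_real (- (- z)) \<odot> e"
        using hc[OF x] by (simp add: lincomb)
      finally have "- z \<in> T x"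
        by (simp add: T_def)
      then show "- g x \<le> z"
        using g_upper[OF _ x] by fastforce
    qed
  qed
  have g_add: "g (x \<oplus> y) = g x + g y" if x: "x \<in> hermitian V" and y: "y \<in> hermitian V" for x y
  proof -
    have "\<ominus> (x \<oplus> y) = \<ominus> x \<oplus> \<ominus> y"
      using hc[OF x] hc[OF y] by (simp add: lincomb)
    then have "- g x - g y \<le> - g (x \<oplus> y)"
      using g_super[OF hermitian_minus[OF x] hermitian_minus[OF y]]
        g_minus[OF x] g_minus[OF y] g_minus[OF hermitian_add[OF x y]]
      by simp
    then show ?thesis
      using g_super[OF x y] by simp
  qed
  have g_nonneg_smult: "r * g x \<le> g (complex_of_real r \<odot> x)"
    if x: "x \<in> hermitian V" and "r > 0" for r x
  proof -
    have "t \<le> g (complex_of_real r \<odot> x) / r" if "t \<in> T x" for t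
    proof -
      have "complex_of_real r \<odot> x \<oplus> complex_of_real (- (r * t)) \<odot> e
          = complex_of_real r \<odot> (x \<oplus> complex_of_real (- t) \<odot> e)"
        using hc[OF x] by (simp add: lincomb)
      also have "\<dots> \<in> C"
        using that \<open>r > 0\<close> by (intro C_smult) (simp_all add: T_def)
      finally have "r * t \<in> T (complex_of_real r \<odot> x)"
        by (simp add: T_def)
      then show ?thesis
        using g_upper hermitian_smult[OF x, of r] \<open>r > 0\<close>
        by (simp add: pos_le_divide_eq mult.commute)
    qed
    then have "g x \<le> g (complex_of_real r \<odot> x) / r"
      by (intro g_least x)
    then show ?thesis
      using \<open>r > 0\<close> by (simp add: pos_le_divide_eq mult.commute)
  qed
  have g_pos_smult: "g (complex_of_real r \<odot> x) = r * g x"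
    if x: "x \<in> hermitian V" and r: "r > 0" for r x
  proof -
    have "complex_of_real r \<odot> (\<ominus> x) = \<ominus> (complex_of_real r \<odot> x)"
      using hc[OF x] by (simp add: lincomb)
    then have "- (r * g x) \<le> - g (complex_of_real r \<odot> x)"
      using g_nonneg_smult[OF hermitian_minus[OF x] r] g_minus x hermitian_smult by simp
    then show ?thesis
      using g_nonneg_smult[OF x r] by simp
  qed
  have g_zero: "g \<zero> = 0"
    using g_add[OF hermitian_zero hermitian_zero] by simp
  have g_smult: "g (complex_of_real r \<odot> x) = r * g x" if x: "x \<in> hermitian V" for r x
  proof (cases r "0 :: real" rule: linorder_cases)
    case less
    have "complex_of_real r \<odot> x = complex_of_real (- r) \<odot> (\<ominus> x)"
      using hc[OF x] by (simp add: lincomb)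
    then show ?thesis
      using g_pos_smult[OF hermitian_minus[OF x], of "- r"] less g_minus[OF x] by simp
  next
    case equal
    then show ?thesis
      using hc[OF x] g_zero by simp
  qed (rule g_pos_smult[OF x])
  have g_nonneg: "g x \<ge> 0" if "x \<in> C" for x
    using that C C_carrier by (intro g_upper) (auto simp: T_def extension_cones_def)
  have "g e = 1"
  proof (rule antisym)
    show "g e \<le> 1"
    proof (rule g_least)
      fix t assume "t \<in> T e"
      then have "complex_of_real (1 - t) \<odot> e \<in> C"
        by (simp add: T_def lincomb)
      then show "t \<le> 1"
        using unit_multiple by fastforce
    qed (rule unit_hermitian)
    have "e \<oplus> complex_of_real (- 1) \<odot> e = \<zero>"
      using smult_combine[of e 1 "- 1"] by simp
    then have "1 \<in> T e"
      using cone_C[OF zero_in_cone] by (simp add: T_def)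
    then show "g e \<ge> 1"
      by (rule g_upper) (rule unit_hermitian)
  qed
  with g_add g_smult g_nonneg show thesis
    by (intro that[of g])
qed

text \<open>
  The adjoined element \<open>y = -(re + v)\<close> does not produce \<open>-e\<close>: from \<open>c + sy = -e\<close> with \<open>s > 0\<close> and
  \<open>c\<close> positive it would follow that \<open>re + v = (c + e) / s\<close> is positive.
\<close>

lemma state_separating:
  assumes v: "v \<in> hermitian V" and r: "r > 0"
    and notin: "complex_of_real r \<odot> e \<oplus> v \<notin> cone V"
  obtains f where "f \<in> states V e" "Re (f v) < 0"
proof -
  let ?y = "\<ominus> (complex_of_real r \<odot> e \<oplus> v)"
  have y: "?y \<in> hermitian V"
    by (intro hermitian_minus hermitian_add hermitian_smult unit_hermitian v)
  have carrier_v [simp]: "v \<in> carrier V"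
    using v by (rule hermitian_carrier)
  obtain C0 where "C0 \<in> extension_cones" "?y \<in> C0"
  proof (rule adjoin_to_extension_cone[of "cone V" ?y])
    fix c s assume c: "c \<in> cone V" and s: "(s::real) \<ge> 0"
    note [simp] = cone_imp_carrier[OF c]
    show "c \<oplus> complex_of_real s \<odot> ?y \<noteq> \<ominus> e"
    proof
      assume eq: "c \<oplus> complex_of_real s \<odot> ?y = \<ominus> e"
      show False
      proof (cases "s = 0")
        case True
        then have "\<ominus> e \<in> cone V"
          using eq c by simp
        then have "e = \<zero>" "v = \<zero>"
          using trivial_if_minus_unit_in_cone v unit_hermitian by blast+
        then show False
          using notin zero_in_cone by simp
      next
        case False
        have "complex_of_real s \<odot> (complex_of_real r \<odot> e \<oplus> v)
            = c \<oplus> \<ominus> (c \<oplus> complex_of_real s \<odot> ?y)"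
          by (simp add: lincomb)
        also have "\<dots> = c \<oplus> e"
          using eq by simp
        finally have "complex_of_real s \<odot> (complex_of_real r \<odot> e \<oplus> v) = c \<oplus> e" .
        then have "complex_of_real s \<odot> (complex_of_real r \<odot> e \<oplus> v) \<in> cone V"
          using c unit_in_cone by (simp add: cone_add)
        then have "complex_of_real (1 / s) \<odot> (complex_of_real s \<odot> (complex_of_real r \<odot> e \<oplus> v)) \<in> cone V"
          by (rule cone_smult) (use s in simp)
        then have "complex_of_real r \<odot> e \<oplus> v \<in> cone V"
          using False smult_divide_cancel[of "complex_of_real r \<odot> e \<oplus> v" s] by simp
        then show False
          using notin by simp
      qed
    qed
  qed (use cone_hermitian y cone_add cone_smult in auto)
  then obtain C where C: "C \<in> extension_cones" "?y \<in> C"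
    and total: "\<And>x. x \<in> hermitian V \<Longrightarrow> x \<in> C \<or> \<ominus> x \<in> C"
    using extension_cone_contains_total by blast
  obtain g :: "'v \<Rightarrow> real" where
    g_add: "\<And>x y. x \<in> hermitian V \<Longrightarrow> y \<in> hermitian V \<Longrightarrow> g (x \<oplus> y) = g x + g y"
    and g_smult: "\<And>r x. x \<in> hermitian V \<Longrightarrow> g (complex_of_real r \<odot> x) = r * g x"
    and g_nonneg: "\<And>x. x \<in> C \<Longrightarrow> g x \<ge> 0" and g_unit: "g e = 1"
    using total_extension_cone_functional[OF C(1) total] by blast
  obtain f where f: "f \<in> linear_maps V complex_space"
    "\<And>x. x \<in> hermitian V \<Longrightarrow> f x = complex_of_real (g x)"
    using complexify_functional[of g] g_add g_smult by blast
  show thesis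
  proof
    show "f \<in> states V e"
      using f g_nonneg g_unit C(1) unit_hermitian cone_imp_hermitian
      by (auto simp: states_def positive_maps_def extension_cones_def)
    have "?y = complex_of_real (- r) \<odot> e \<oplus> complex_of_real (- 1) \<odot> v"
      by (simp add: lincomb)
    then have "g ?y = - r - g v"
      using g_add[of "complex_of_real (- r) \<odot> e" "complex_of_real (- 1) \<odot> v"]
        g_smult[OF v, of "- 1"] g_smult[OF unit_hermitian, of "- r"] g_unit v
        hermitian_smult[OF v, of "- 1"] hermitian_smult[OF unit_hermitian, of "- r"]
      by simp
    then show "Re (f v) < 0"
      using g_nonneg[OF C(2)] r f(2)[OF v] by simp
  qed
qed

end

section \<open>Positive maps and states\<close>

lemma linear_mapsD:
  assumes "f \<in> linear_maps V W"
  shows "f \<in> extensional (carrier V)"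
    and "x \<in> carrier V \<Longrightarrow> f x \<in> carrier W"
    and "x \<in> carrier V \<Longrightarrow> y \<in> carrier V \<Longrightarrow> f (x \<oplus>\<^bsub>V\<^esub> y) = f x \<oplus>\<^bsub>W\<^esub> f y"
    and "x \<in> carrier V \<Longrightarrow> f (c \<odot>\<^bsub>V\<^esub> x) = c \<odot>\<^bsub>W\<^esub> f x"
  using assms by (auto simp: linear_maps_def PiE_def)

lemma positive_mapsD:
  assumes "f \<in> positive_maps V W"
  shows "f \<in> linear_maps V W" and "x \<in> cone V \<Longrightarrow> f x \<in> cone W"
  using assms by (auto simp: positive_maps_def)

context order_unit_space
begin

text \<open>
  Positive maps preserve hermitian elements, because each hermitian \<open>x\<close> is the difference
  \<open>re - (re - x)\<close> of positive elements.
\<close>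

lemma positive_map_hermitian:
  assumes "ordered_star_space W" and \<phi>: "\<phi> \<in> positive_maps V W" and x: "x \<in> hermitian V"
  shows "\<phi> x \<in> hermitian W"
proof -
  interpret W: ordered_star_space W by fact
  note lin = linear_mapsD[OF positive_mapsD(1)[OF \<phi>]] and pos = positive_mapsD(2)[OF \<phi>]
  obtain r where r: "r > 0" "complex_of_real r \<odot> e \<ominus> x \<in> cone V"
    using unit_dominates[OF x] by blast
  have "x = complex_of_real r \<odot> e \<oplus> complex_of_real (- 1) \<odot> (complex_of_real r \<odot> e \<ominus> x)"
    using hermitian_carrier[OF x] by (simp add: lincomb)
  then have "\<phi> x = complex_of_real r \<odot>\<^bsub>W\<^esub> \<phi> e
      \<oplus>\<^bsub>W\<^esub> complex_of_real (- 1) \<odot>\<^bsub>W\<^esub> \<phi> (complex_of_real r \<odot> e \<ominus> x)"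
    using lin(3,4) cone_imp_carrier[OF r(2)] by (metis smult_in_carrier unit_carrier)
  then show ?thesis
    using pos[OF unit_in_cone] pos[OF r(2)]
    by (simp only:) (intro W.hermitian_add W.hermitian_smult W.cone_imp_hermitian)
qed

lemma statesD:
  assumes "f \<in> states V e"
  shows "f \<in> positive_maps V complex_space" and "f e = 1"
    and "x \<in> carrier V \<Longrightarrow> y \<in> carrier V \<Longrightarrow> f (x \<oplus> y) = f x + f y"
    and "x \<in> carrier V \<Longrightarrow> f (c \<odot> x) = c * f x"
    and "x \<in> carrier V \<Longrightarrow> f (\<ominus> x) = - f x"
    and "f \<zero> = 0"
    and "x \<in> cone V \<Longrightarrow> f x \<in> complex_of_real ` {0..}"
    and "x \<in> hermitian V \<Longrightarrow> Im (f x) = 0"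
proof -
  show *: "f \<in> positive_maps V complex_space" "f e = 1"
    using assms by (simp_all add: states_def)
  show "f (x \<oplus> y) = f x + f y" if "x \<in> carrier V" "y \<in> carrier V"
    using linear_mapsD(3)[OF positive_mapsD(1)[OF *(1)] that] by simp
  show smult: "f (c \<odot> x) = c * f x" if "x \<in> carrier V" for x c
    using linear_mapsD(4)[OF positive_mapsD(1)[OF *(1)] that] by simp
  show "f (\<ominus> x) = - f x" if "x \<in> carrier V"
    using smult[OF that, of "- 1"] minus_smult[OF that] by simp
  show "f \<zero> = 0"
    using smult[of \<zero> 0] by simp
  show "f x \<in> complex_of_real ` {0..}" if "x \<in> cone V"
    using positive_mapsD(2)[OF *(1) that] by simp
  show "Im (f x) = 0" if "x \<in> hermitian V"
    using positive_map_hermitian[OF ordered_star_space_complex_space *(1) that]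
    by (simp add: hermitian_def complex_space_def complex_eq_iff)
qed

lemma state_hermitian_part:
  assumes "f \<in> states V e" "x \<in> carrier V"
  shows "f (hermitian_part x) = complex_of_real (Re (f x))"
proof -
  have "f x = f (hermitian_part x) + \<i> * f (hermitian_part ((- \<i>) \<odot> x))"
    using assms(2) statesD(3,4)[OF assms(1)] hermitian_decomposition[of x]
    by (metis hermitian_part_carrier smult_in_carrier)
  moreover have "Im (f (hermitian_part x)) = 0" "Im (f (hermitian_part ((- \<i>) \<odot> x))) = 0"
    using assms by (simp_all add: statesD(8) hermitian_part_hermitian)
  ultimately show ?thesis
    by (simp add: complex_eq_iff)
qed

lemma state_star:
  assumes "f \<in> states V e" "x \<in> carrier V"
  shows "f (star V x) = cnj (f x)"
proof -
  have "f (x \<oplus> star V x) = f (2 \<odot> hermitian_part x)"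
    using assms(2) by (simp add: hermitian_part_def star_closed smult_smult)
  then show ?thesis
    using assms state_hermitian_part[OF assms] by (simp add: statesD star_closed complex_eq_iff)
qed

text \<open>
  The description of \<open>D\<close> by states. In the zero space it holds because both sides are true of 0.
\<close>

lemma arch_D_iff_states:
  "v \<in> arch_D V e \<longleftrightarrow> v \<in> hermitian V \<and> (\<forall>f\<in>states V e. 0 \<le> Re (f v))"
proof (intro iffI conjI ballI)
  assume v: "v \<in> arch_D V e"
  show herm: "v \<in> hermitian V"
    using v by (simp add: arch_D_def)
  fix f assume f: "f \<in> states V e"
  have "0 \<le> Re (f v) + r" if "r > 0" for r
  proof -
    have "f (complex_of_real r \<odot> e \<oplus> v) \<in> complex_of_real ` {0..}"
      using v that by (intro statesD(7)[OF f]) (simp add: arch_D_def)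
    then show ?thesis
      using statesD(2-4)[OF f] hermitian_carrier[OF herm] by (simp add: in_nonneg_reals_iff)
  qed
  then show "0 \<le> Re (f v)"
    by (rule field_le_epsilon)
next
  assume v: "v \<in> hermitian V \<and> (\<forall>f\<in>states V e. 0 \<le> Re (f v))"
  have "complex_of_real r \<odot> e \<oplus> v \<in> cone V" if r: "r > 0" for r
  proof (rule ccontr)
    assume "complex_of_real r \<odot> e \<oplus> v \<notin> cone V"
    then obtain f where "f \<in> states V e" "Re (f v) < 0"
      using state_separating v r by blast
    with v show False
      by (meson not_less)
  qed
  with v show "v \<in> arch_D V e"
    by (simp add: arch_D_def)
qed

section \<open>The Archimedeanization\<close>

abbreviation "N \<equiv> arch_N V e"
abbreviation "A \<equiv> archimedeanization V e"

lemma mem_arch_N_iff: "x \<in> N \<longleftrightarrow> x \<in> carrier V \<and> (\<forall>f\<in>states V e. f x = 0)"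
  by (simp add: arch_N_def)

lemma coset_eq_Collect:
  assumes x: "x \<in> carrier V"
  shows "N +> x = {y \<in> carrier V. \<forall>f\<in>states V e. f y = f x}"
proof (intro equalityI subsetI)
  fix y assume "y \<in> N +> x"
  then show "y \<in> {y \<in> carrier V. \<forall>f\<in>states V e. f y = f x}"
    using x by (auto simp: a_r_coset_def' arch_N_def statesD(3))
next
  fix y assume y: "y \<in> {y \<in> carrier V. \<forall>f\<in>states V e. f y = f x}"
  then have "y \<oplus> \<ominus> x \<in> N"
    using x by (simp add: arch_N_def statesD(3,5))
  moreover have "y = (y \<oplus> \<ominus> x) \<oplus> x"
    using x y by (simp add: a_assoc l_neg)
  ultimately show "y \<in> N +> x"
    unfolding a_r_coset_def' by blast
qed

lemma coset_eq_iff: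
  assumes "x \<in> carrier V" "y \<in> carrier V"
  shows "N +> x = N +> y \<longleftrightarrow> (\<forall>f\<in>states V e. f x = f y)"
  using assms by (auto simp: coset_eq_Collect set_eq_iff)

lemma arch_zero: "\<zero>\<^bsub>A\<^esub> = N +> \<zero>"
  by (auto simp: archimedeanization_def Let_def coset_eq_Collect arch_N_def statesD(6))

lemma arch_carrier_iff: "X \<in> carrier A \<longleftrightarrow> (\<exists>x\<in>carrier V. X = N +> x)"
  by (auto simp: archimedeanization_def Let_def A_RCOSETS_def')

lemma coset_in_arch_carrier [simp]: "x \<in> carrier V \<Longrightarrow> N +> x \<in> carrier A"
  by (auto simp: arch_carrier_iff)

lemma arch_add:
  assumes x: "x \<in> carrier V" and y: "y \<in> carrier V"
  shows "(N +> x) \<oplus>\<^bsub>A\<^esub> (N +> y) = N +> (x \<oplus> y)"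
proof -
  have "(N +> x) <+>\<^bsub>V\<^esub> (N +> y) = N +> (x \<oplus> y)"
  proof (intro equalityI subsetI)
    fix z assume "z \<in> (N +> x) <+>\<^bsub>V\<^esub> (N +> y)"
    then show "z \<in> N +> (x \<oplus> y)"
      using x y by (auto simp: set_add_def' coset_eq_Collect statesD(3))
  next
    fix z assume "z \<in> N +> (x \<oplus> y)"
    then have "z \<oplus> \<ominus> y \<in> N +> x" "y \<in> N +> y" "z = (z \<oplus> \<ominus> y) \<oplus> y"
      using x y by (auto simp: coset_eq_Collect statesD(3,5) a_assoc l_neg)
    then show "z \<in> (N +> x) <+>\<^bsub>V\<^esub> (N +> y)"
      unfolding set_add_def' by blast
  qed
  then show ?thesis
    by (simp add: archimedeanization_def Let_def)
qed

lemma arch_smult: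
  assumes x: "x \<in> carrier V"
  shows "c \<odot>\<^bsub>A\<^esub> (N +> x) = N +> (c \<odot> x)"
proof -
  have "N <+>\<^bsub>V\<^esub> ((\<lambda>y. c \<odot> y) ` (N +> x)) = N +> (c \<odot> x)"
  proof (intro equalityI subsetI)
    fix z assume "z \<in> N <+>\<^bsub>V\<^esub> ((\<lambda>y. c \<odot> y) ` (N +> x))"
    then show "z \<in> N +> (c \<odot> x)"
      using x by (auto simp: set_add_def' coset_eq_Collect mem_arch_N_iff statesD(3,4))
  next
    fix z assume "z \<in> N +> (c \<odot> x)"
    then have "z \<oplus> \<ominus> (c \<odot> x) \<in> N" "x \<in> N +> x" "z = (z \<oplus> \<ominus> (c \<odot> x)) \<oplus> c \<odot> x"
      using x by (auto simp: coset_eq_Collect mem_arch_N_iff statesD(3,5) a_assoc l_neg)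
    then show "z \<in> N <+>\<^bsub>V\<^esub> ((\<lambda>y. c \<odot> y) ` (N +> x))"
      unfolding set_add_def' by blast
  qed
  then show ?thesis
    by (simp add: archimedeanization_def Let_def)
qed

lemma arch_star:
  assumes x: "x \<in> carrier V"
  shows "star A (N +> x) = N +> star V x"
proof -
  have "star V ` (N +> x) = N +> star V x"
  proof (intro equalityI subsetI)
    fix z assume "z \<in> N +> star V x"
    then have "star V z \<in> N +> x" "z = star V (star V z)"
      using x by (auto simp: coset_eq_Collect state_star star_closed star_star)
    then show "z \<in> star V ` (N +> x)"
      by blast
  qed (use x in \<open>auto simp: coset_eq_Collect state_star star_closed\<close>)
  then show ?thesis
    by (simp add: archimedeanization_def Let_def)
qed

lemma arch_hermitian_iff:
  assumes x: "x \<in> carrier V"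
  shows "N +> x \<in> hermitian A \<longleftrightarrow> (\<forall>f\<in>states V e. Im (f x) = 0)"
  using x by (auto simp: hermitian_def arch_star coset_eq_iff star_closed state_star complex_eq_iff)

text \<open>
  For the representative in \<open>D\<close> of a coset on which all states are nonnegative, the hermitian part
  is taken: an arbitrary representative need not be hermitian.
\<close>

lemma arch_cone_iff:
  assumes x: "x \<in> carrier V"
  shows "N +> x \<in> cone A \<longleftrightarrow> (\<forall>f\<in>states V e. f x \<in> complex_of_real ` {0..})"
proof -
  have cone: "N +> x \<in> cone A \<longleftrightarrow> (\<exists>d\<in>arch_D V e. N +> x = N +> d)"
    by (auto simp: archimedeanization_def Let_def)
  show ?thesis
  proof
    assume "N +> x \<in> cone A"
    then obtain d where d: "d \<in> arch_D V e" "N +> x = N +> d"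
      using cone by blast
    then show "\<forall>f\<in>states V e. f x \<in> complex_of_real ` {0..}"
      using x coset_eq_iff[of x d] statesD(8)
      by (auto simp: arch_D_iff_states hermitian_carrier in_nonneg_reals_iff)
  next
    assume *: "\<forall>f\<in>states V e. f x \<in> complex_of_real ` {0..}"
    then have "hermitian_part x \<in> arch_D V e" "N +> x = N +> hermitian_part x"
      using x by (auto simp: arch_D_iff_states hermitian_part_hermitian state_hermitian_part coset_eq_iff)
    then show "N +> x \<in> cone A"
      using cone by blast
  qed
qed

lemma arch_cone_subset_carrier: "X \<in> cone A \<Longrightarrow> \<exists>x\<in>carrier V. X = N +> x"
  by (auto simp: archimedeanization_def Let_def arch_D_iff_states hermitian_carrier)

lemma arch_abelian_group: "abelian_group A"
proof (rule abelian_groupI)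
  fix X assume "X \<in> carrier A"
  then obtain x where "x \<in> carrier V" "X = N +> x"
    by (auto simp: arch_carrier_iff)
  then show "\<exists>Y\<in>carrier A. Y \<oplus>\<^bsub>A\<^esub> X = \<zero>\<^bsub>A\<^esub>"
    by (intro bexI[of _ "N +> \<ominus> x"]) (simp_all add: arch_add arch_zero l_neg)
qed (auto simp: arch_carrier_iff arch_add arch_zero a_ac)

lemma arch_minus:
  assumes "x \<in> carrier V"
  shows "\<ominus>\<^bsub>A\<^esub> (N +> x) = N +> \<ominus> x"
  using assms
  by (intro abelian_group.minus_equality[OF arch_abelian_group]) (simp_all add: arch_add arch_zero l_neg)

lemma arch_module: "module complex_field A"
proof (rule moduleI[OF cring_complex_field arch_abelian_group])
qed (auto simp: arch_carrier_iff arch_add arch_smult smult_add_right smult_smult simp flip: smult_combine)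

lemma arch_ordered_star_space: "ordered_star_space A"
proof -
  have "star_vector_space A"
    unfolding star_vector_space_def
  proof (intro conjI arch_module)
    show "star_vector_space_axioms A"
      by unfold_locales
        (auto simp: arch_carrier_iff arch_add arch_smult arch_star star_closed star_star star_add
          star_smult)
  qed
  moreover have "ordered_star_space_axioms A"
  proof
    show "cone A \<noteq> {}"
      using arch_cone_iff[of \<zero>] statesD(6) by force
    show "cone A \<subseteq> hermitian A"
    proof
      fix X assume "X \<in> cone A"
      then obtain x where "x \<in> carrier V" "X = N +> x" "N +> x \<in> cone A"
        using arch_cone_subset_carrier by blast
      then show "X \<in> hermitian A"
        by (auto simp: arch_hermitian_iff arch_cone_iff in_nonneg_reals_iff)
    qed
    show "X \<oplus>\<^bsub>A\<^esub> Y \<in> cone A" if "X \<in> cone A" "Y \<in> cone A" for X Y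
      using arch_cone_subset_carrier[OF that(1)] arch_cone_subset_carrier[OF that(2)] that
      by (auto simp: arch_add arch_cone_iff statesD(3) in_nonneg_reals_iff)
    show "complex_of_real r \<odot>\<^bsub>A\<^esub> X \<in> cone A" if "X \<in> cone A" "0 \<le> r" for X r
      using arch_cone_subset_carrier[OF that(1)] that
      by (auto simp: arch_smult arch_cone_iff statesD(4) in_nonneg_reals_iff)
    show "cone A \<inter> a_inv A ` cone A = {\<zero>\<^bsub>A\<^esub>}"
    proof (intro equalityI subsetI)
      fix X assume "X \<in> cone A \<inter> a_inv A ` cone A"
      then obtain Y where "X \<in> cone A" "Y \<in> cone A" "X = \<ominus>\<^bsub>A\<^esub> Y"
        by auto
      then obtain x y where xy: "x \<in> carrier V" "y \<in> carrier V" "X = N +> x" "N +> x \<in> cone A"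
        "N +> y \<in> cone A" "N +> x = \<ominus>\<^bsub>A\<^esub> (N +> y)"
        using arch_cone_subset_carrier by metis
      then have "\<forall>f\<in>states V e. f x = - f y"
        using arch_minus coset_eq_iff[of x "\<ominus> y"] statesD(5) by auto
      then have "\<forall>f\<in>states V e. f x = f \<zero>"
        using xy arch_cone_iff statesD(6) by (fastforce simp: in_nonneg_reals_iff complex_eq_iff)
      then show "X \<in> {\<zero>\<^bsub>A\<^esub>}"
        using xy coset_eq_iff[of x \<zero>] by (simp add: arch_zero)
    next
      fix X assume "X \<in> {\<zero>\<^bsub>A\<^esub>}"
      moreover have "\<zero>\<^bsub>A\<^esub> \<in> cone A"
        using statesD(6) by (force simp: arch_zero arch_cone_iff)
      moreover have "\<ominus>\<^bsub>A\<^esub> \<zero>\<^bsub>A\<^esub> = \<zero>\<^bsub>A\<^esub>"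
        unfolding arch_zero using arch_minus[of \<zero>] by (simp add: minus_smult)
      ultimately show "X \<in> cone A \<inter> a_inv A ` cone A"
        by (auto simp: image_iff intro!: bexI[of _ "\<zero>\<^bsub>A\<^esub>"])
    qed
  qed
  ultimately show ?thesis
    by (simp add: ordered_star_space_def)
qed

lemma arch_archimedean_order_unit: "archimedean_order_unit A (arch_unit V e)"
proof -
  interpret A: ordered_star_space A
    by (rule arch_ordered_star_space)
  have unit: "arch_unit V e = N +> e"
    by (simp add: arch_unit_def)
  have "order_unit A (N +> e)"
    unfolding order_unit_def
  proof (intro conjI ballI)
    show "N +> e \<in> hermitian A"
      by (simp add: arch_hermitian_iff statesD(2))
    fix X assume "X \<in> hermitian A"
    then obtain x where x: "x \<in> carrier V" "X = N +> x" "N +> x \<in> hermitian A"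
      using A.hermitian_carrier[of X] unfolding arch_carrier_iff by metis
    obtain r where r: "r > 0" "complex_of_real r \<odot> e \<ominus> hermitian_part x \<in> cone V"
      using unit_dominates[OF hermitian_part_hermitian[OF x(1)]] by blast
    have "f (complex_of_real r \<odot> e \<ominus> x) \<in> complex_of_real ` {0..}" if f: "f \<in> states V e" for f
    proof -
      have "Im (f x) = 0"
        using x f by (simp add: arch_hermitian_iff)
      then have "f (complex_of_real r \<odot> e \<ominus> x) = f (complex_of_real r \<odot> e \<ominus> hermitian_part x)"
        using x(1) f by (simp add: a_minus_def statesD(3,5) state_hermitian_part complex_eq_iff)
      then show ?thesis
        using statesD(7)[OF f r(2)] by simp
    qed
    then have "N +> (complex_of_real r \<odot> e \<ominus> x) \<in> cone A"
      using x(1) by (simp add: arch_cone_iff)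
    then show "\<exists>r>0. complex_of_real r \<odot>\<^bsub>A\<^esub> (N +> e) \<ominus>\<^bsub>A\<^esub> X \<in> cone A"
      using r(1) x(1,2) by (intro exI[of _ r]) (simp add: a_minus_def arch_smult arch_minus arch_add)
  qed
  moreover have "X \<in> cone A"
    if herm: "X \<in> hermitian A" and pos: "\<And>r. r > 0 \<Longrightarrow> complex_of_real r \<odot>\<^bsub>A\<^esub> (N +> e) \<oplus>\<^bsub>A\<^esub> X \<in> cone A" for X
  proof -
    obtain x where x: "x \<in> carrier V" "X = N +> x" "N +> x \<in> hermitian A"
      using herm A.hermitian_carrier[of X] unfolding arch_carrier_iff by metis
    have *: "0 \<le> Re (f x) + r" if f: "f \<in> states V e" and r: "r > 0" for f r
    proof -
      have "N +> (complex_of_real r \<odot> e \<oplus> x) \<in> cone A"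
        using pos[OF r] x(1,2) by (simp add: arch_smult arch_add)
      then have "f (complex_of_real r \<odot> e \<oplus> x) \<in> complex_of_real ` {0..}"
        using x(1) f by (simp add: arch_cone_iff)
      then show ?thesis
        using x(1) f by (simp add: statesD(2-4) in_nonneg_reals_iff)
    qed
    have "0 \<le> Re (f x)" if f: "f \<in> states V e" for f
      by (rule field_le_epsilon) (rule *[OF f])
    then show ?thesis
      using x(1,3) unfolding x(2) by (simp add: arch_cone_iff arch_hermitian_iff in_nonneg_reals_iff)
  qed
  ultimately show ?thesis
    by (auto simp: archimedean_order_unit_def unit)
qed

text \<open>
  The canonical map \<open>q\<close>, restricted to the carrier so that equality of maps is equality of
  functions.
\<close>

definition quotient_map :: "'v \<Rightarrow> 'v set"
  where "quotient_map = (\<lambda>v\<in>carrier V. N +> v)"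

lemma quotient_map_surj: "quotient_map ` carrier V = carrier A"
  by (auto simp: quotient_map_def arch_carrier_iff)

lemma quotient_map_unital: "quotient_map e = arch_unit V e"
  by (simp add: quotient_map_def arch_unit_def)

lemma quotient_map_positive: "quotient_map \<in> positive_maps V A"
  unfolding positive_maps_def linear_maps_def
  using arch_cone_iff cone_imp_carrier statesD(7)
  by (auto simp: quotient_map_def arch_add arch_smult)

section \<open>The universal property\<close>

lemma positive_map_arch_D:
  assumes "ordered_star_space W" "archimedean_order_unit W e'"
    and \<phi>: "\<phi> \<in> positive_maps V W" "\<phi> e = e'" and d: "d \<in> arch_D V e"
  shows "\<phi> d \<in> cone W"
proof -
  interpret W: ordered_star_space W by fact
  have d': "d \<in> hermitian V"
    using d by (simp add: arch_D_def)
  have "complex_of_real r \<odot>\<^bsub>W\<^esub> e' \<oplus>\<^bsub>W\<^esub> \<phi> d \<in> cone W" if "r > 0" for r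
    using positive_mapsD(2)[OF \<phi>(1), of "complex_of_real r \<odot> e \<oplus> d"] d d' that
      linear_mapsD(3,4)[OF positive_mapsD(1)[OF \<phi>(1)]] \<phi>(2)
    by (simp add: arch_D_def hermitian_carrier)
  then show ?thesis
    using assms(2) positive_map_hermitian[OF assms(1) \<phi>(1) d']
    by (simp add: archimedean_order_unit_def)
qed

lemma positive_map_arch_N:
  assumes "ordered_star_space W" "archimedean_order_unit W e'"
    and \<phi>: "\<phi> \<in> positive_maps V W" "\<phi> e = e'" and x: "x \<in> N"
  shows "\<phi> x = \<zero>\<^bsub>W\<^esub>"
proof -
  interpret W: ordered_star_space W by fact
  note lin = linear_mapsD[OF positive_mapsD(1)[OF \<phi>(1)]]
  have *: "\<phi> (hermitian_part y) = \<zero>\<^bsub>W\<^esub>" if y: "y \<in> N" for y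
  proof -
    let ?h = "hermitian_part y"
    have yc: "y \<in> carrier V" and y0: "\<And>f. f \<in> states V e \<Longrightarrow> f y = 0"
      using y by (auto simp: mem_arch_N_iff)
    have "Re (f ?h) = 0" "Re (f (\<ominus> ?h)) = 0" if "f \<in> states V e" for f
      using yc y0[OF that] that by (simp_all add: state_hermitian_part statesD(5))
    then have "?h \<in> arch_D V e" "\<ominus> ?h \<in> arch_D V e"
      unfolding arch_D_iff_states using yc
      by (metis hermitian_part_hermitian hermitian_minus order.refl)+
    then have "\<phi> ?h \<in> cone W" "\<phi> (\<ominus> ?h) \<in> cone W"
      using positive_map_arch_D[OF assms(1-4)] by blast+
    moreover have "\<phi> (\<ominus> ?h) = \<ominus>\<^bsub>W\<^esub> \<phi> ?h"
      using yc lin(2,4) by (simp add: minus_smult W.minus_smult)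
    ultimately show ?thesis
      using W.cone_antisym by simp
  qed
  have xc: "x \<in> carrier V" and "(- \<i>) \<odot> x \<in> N"
    using x by (auto simp: mem_arch_N_iff statesD(4))
  then have "\<phi> (hermitian_part x \<oplus> \<i> \<odot> hermitian_part ((- \<i>) \<odot> x)) = \<zero>\<^bsub>W\<^esub>"
    using *[OF x] * lin(3,4) by (simp del: minus_smult)
  then show ?thesis
    using hermitian_decomposition[OF xc] by simp
qed

lemma positive_map_factors_uniquely:
  assumes W: "ordered_star_space W" "archimedean_order_unit W e'"
    and \<phi>: "\<phi> \<in> positive_maps V W" "\<phi> e = e'"
  shows "\<exists>!\<phi>'. \<phi>' \<in> positive_maps A W \<and> \<phi> = compose (carrier V) \<phi>' quotient_map"
proof -
  interpret W: ordered_star_space W by fact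
  interpret A: ordered_star_space A by (rule arch_ordered_star_space)
  note lin = linear_mapsD[OF positive_mapsD(1)[OF \<phi>(1)]]
  have const: "\<phi> x = \<phi> y" if "x \<in> carrier V" "y \<in> carrier V" "N +> x = N +> y" for x y
  proof -
    have "x \<oplus> \<ominus> y \<in> N"
      using that(1,2) that(3)[unfolded coset_eq_iff[OF that(1,2)]]
      by (simp add: mem_arch_N_iff statesD(3,5))
    then have "\<phi> ((x \<oplus> \<ominus> y) \<oplus> y) = \<phi> y"
      using that positive_map_arch_N[OF assms] lin(2,3) by simp
    then show ?thesis
      using that by (simp add: a_assoc l_neg)
  qed
  \<comment> \<open>The value on a coset is taken at a chosen representative; the choice is immaterial by \<open>const\<close>.\<close>
  define \<psi> where "\<psi> = (\<lambda>X\<in>carrier A. \<phi> (SOME x. x \<in> carrier V \<and> X = N +> x))"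
  have \<psi>: "\<psi> (N +> x) = \<phi> x" if x: "x \<in> carrier V" for x
  proof -
    have "\<exists>y. y \<in> carrier V \<and> N +> x = N +> y"
      using x by blast
    from someI_ex[OF this] show ?thesis
      using x by (auto simp: \<psi>_def intro: const)
  qed
  show ?thesis
  proof (intro ex1I conjI)
    show "\<psi> \<in> positive_maps A W"
      unfolding positive_maps_def linear_maps_def
    proof (intro CollectI conjI ballI allI)
      show "\<psi> \<in> carrier A \<rightarrow>\<^sub>E carrier W"
        using \<psi> lin(2) by (auto simp: arch_carrier_iff) (auto simp: \<psi>_def arch_carrier_iff)
      show "\<psi> ` cone A \<subseteq> cone W"
      proof
        fix w assume "w \<in> \<psi> ` cone A"
        then obtain d where "d \<in> arch_D V e" "w = \<psi> (N +> d)"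
          by (auto simp: archimedeanization_def Let_def)
        then show "w \<in> cone W"
          using \<psi> positive_map_arch_D[OF assms] by (simp add: arch_D_def hermitian_carrier)
      qed
    qed (auto simp: arch_carrier_iff arch_add arch_smult \<psi> lin)
    show "\<phi> = compose (carrier V) \<psi> quotient_map"
      using lin(1) by (auto intro!: extensionalityI[of _ "carrier V"]
        simp: compose_def quotient_map_def \<psi>)
    fix \<chi> assume \<chi>: "\<chi> \<in> positive_maps A W \<and> \<phi> = compose (carrier V) \<chi> quotient_map"
    show "\<chi> = \<psi>"
    proof (rule extensionalityI[of _ "carrier A"])
      show "\<chi> \<in> extensional (carrier A)" "\<psi> \<in> extensional (carrier A)"
        using \<chi> linear_mapsD(1) positive_mapsD(1) by (blast, simp add: \<psi>_def)
      fix X assume "X \<in> carrier A"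
      then obtain x where "x \<in> carrier V" "X = N +> x"
        by (auto simp: arch_carrier_iff)
      then show "\<chi> X = \<psi> X"
        using \<chi> \<psi> by (auto simp: compose_def quotient_map_def)
    qed
  qed
qed

text \<open>
  The universal property of \<open>q'\<close> enters through the factorization of \<open>q\<close> over \<open>q'\<close>. The resulting map
  is the inverse of \<open>\<psi>\<close>, and its positivity shows that \<open>\<psi>\<close> reflects the cones.
\<close>

lemma isomorphism_of_universal:
  fixes V' :: "'x ostar"
  assumes V': "ordered_star_space V'" "archimedean_order_unit V' u'"
    and q': "q' \<in> positive_maps V V'" "q' e = u'" "q' ` carrier V = carrier V'"
    and universal: "\<And>(W :: 'v set ostar) e' \<phi>. ordered_star_space W \<Longrightarrow> archimedean_order_unit W e' \<Longrightarrow>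
      \<phi> \<in> positive_maps V W \<Longrightarrow> \<phi> e = e' \<Longrightarrow>
      \<exists>\<phi>'. \<phi>' \<in> positive_maps V' W \<and> \<phi> = compose (carrier V) \<phi>' q'"
  shows "\<exists>\<psi> \<in> order_isomorphisms A V'. \<psi> (arch_unit V e) = u' \<and>
    compose (carrier V) \<psi> quotient_map = q'"
proof -
  obtain \<psi> where \<psi>: "\<psi> \<in> positive_maps A V'" "q' = compose (carrier V) \<psi> quotient_map"
    using positive_map_factors_uniquely[OF V' q'(1,2)] by blast
  obtain \<chi> where \<chi>: "\<chi> \<in> positive_maps V' A" "quotient_map = compose (carrier V) \<chi> q'"
    using universal[OF arch_ordered_star_space arch_archimedean_order_unit quotient_map_positive
        quotient_map_unital] by blast
  note lin = linear_mapsD(2)[OF positive_mapsD(1)[OF \<psi>(1)]]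
    linear_mapsD(2)[OF positive_mapsD(1)[OF \<chi>(1)]]
  have \<psi>_q: "\<psi> (quotient_map x) = q' x" and \<chi>_q': "\<chi> (q' x) = quotient_map x"
    if "x \<in> carrier V" for x
    using fun_cong[OF \<psi>(2), of x] fun_cong[OF \<chi>(2), of x] that by (simp_all add: compose_def)
  have \<chi>_\<psi>: "\<chi> (\<psi> X) = X" if "X \<in> carrier A" for X
    using that \<psi>_q \<chi>_q' by (auto simp flip: quotient_map_surj)
  have \<psi>_\<chi>: "\<psi> (\<chi> y) = y" if "y \<in> carrier V'" for y
    using that \<psi>_q \<chi>_q' by (auto simp flip: q'(3))
  have "bij_betw \<psi> (carrier A) (carrier V')"
    using lin \<chi>_\<psi> \<psi>_\<chi> by (intro bij_betw_byWitness[of _ \<chi>]) auto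
  moreover have "X \<in> cone A \<longleftrightarrow> \<psi> X \<in> cone V'" if "X \<in> carrier A" for X
    using positive_mapsD(2)[OF \<psi>(1), of X] positive_mapsD(2)[OF \<chi>(1), of "\<psi> X"] \<chi>_\<psi>[OF that] by auto
  ultimately have "\<psi> \<in> order_isomorphisms A V'"
    using positive_mapsD(1)[OF \<psi>(1)] by (auto simp: order_isomorphisms_def)
  moreover have "\<psi> (arch_unit V e) = u'"
    using \<psi>_q[of e] q'(2) by (simp add: quotient_map_unital)
  ultimately show ?thesis
    using \<psi>(2) by blast
qed

end

theorem theorem3p16:
  fixes V :: "'v ostar" and e :: 'v
  assumes "ordered_star_space V" and "order_unit V e"
  defines "A \<equiv> archimedeanization V e" and "u \<equiv> arch_unit V e"
  shows "\<exists>q \<in> positive_maps V A.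
    q = (\<lambda>v\<in>carrier V. arch_N V e +>\<^bsub>V\<^esub> v) \<and>
    q e = u \<and> q ` carrier V = carrier A \<and>
    (\<forall>(W :: 'w ostar) e'. ordered_star_space W \<and> archimedean_order_unit W e' \<longrightarrow>
      (\<forall>\<phi> \<in> positive_maps V W. \<phi> e = e' \<longrightarrow>
        (\<exists>!\<phi>'. \<phi>' \<in> positive_maps A W \<and> \<phi> = compose (carrier V) \<phi>' q))) \<and>
    (\<forall>(V' :: 'x ostar) u'. ordered_star_space V' \<and> archimedean_order_unit V' u' \<longrightarrow>
      (\<forall>q' \<in> positive_maps V V'. q' e = u' \<and> q' ` carrier V = carrier V' \<and>
        (\<forall>(W :: 'v set ostar) e'. ordered_star_space W \<and> archimedean_order_unit W e' \<longrightarrow>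
          (\<forall>\<phi> \<in> positive_maps V W. \<phi> e = e' \<longrightarrow>
            (\<exists>!\<phi>'. \<phi>' \<in> positive_maps V' W \<and> \<phi> = compose (carrier V) \<phi>' q'))) \<longrightarrow>
        (\<exists>\<psi> \<in> order_isomorphisms A V'. \<psi> u = u' \<and> compose (carrier V) \<psi> q = q')))"
proof -
  interpret order_unit_space V e
    using assms(1,2) by (simp add: order_unit_space_def order_unit_space_axioms_def)
  show ?thesis
    unfolding A_def u_def
  proof (intro bexI[of _ quotient_map] conjI allI impI ballI)
    show "quotient_map = (\<lambda>v\<in>carrier V. arch_N V e +>\<^bsub>V\<^esub> v)"
      by (rule quotient_map_def)
  next
    fix V' :: "'x ostar" and u' q'
    assume V': "ordered_star_space V' \<and> archimedean_order_unit V' u'"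
      and q': "q' \<in> positive_maps V V'"
      and *: "q' e = u' \<and> q' ` carrier V = carrier V' \<and>
        (\<forall>(W :: 'v set ostar) e'. ordered_star_space W \<and> archimedean_order_unit W e' \<longrightarrow>
          (\<forall>\<phi> \<in> positive_maps V W. \<phi> e = e' \<longrightarrow>
            (\<exists>!\<phi>'. \<phi>' \<in> positive_maps V' W \<and> \<phi> = compose (carrier V) \<phi>' q')))"
    have universal: "\<exists>\<phi>'. \<phi>' \<in> positive_maps V' W \<and> \<phi> = compose (carrier V) \<phi>' q'"
      if "ordered_star_space W" "archimedean_order_unit W e'" "\<phi> \<in> positive_maps V W" "\<phi> e = e'"
      for W :: "'v set ostar" and e' \<phi>
      using * that by blast
    show "\<exists>\<psi> \<in> order_isomorphisms (archimedeanization V e) V'.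
        \<psi> (arch_unit V e) = u' \<and> compose (carrier V) \<psi> quotient_map = q'"
    proof (rule isomorphism_of_universal)
      show "ordered_star_space V'" "archimedean_order_unit V' u'"
        using V' by simp_all
      show "q' e = u'" "q' ` carrier V = carrier V'"
        using * by simp_all
    qed (fact q' universal)+
  next
    fix W :: "'w ostar" and e' \<phi>
    assume "ordered_star_space W \<and> archimedean_order_unit W e'"
      and "\<phi> \<in> positive_maps V W" "\<phi> e = e'"
    then show "\<exists>!\<phi>'. \<phi>' \<in> positive_maps (archimedeanization V e) W \<and>
        \<phi> = compose (carrier V) \<phi>' quotient_map"
      by (intro positive_map_factors_uniquely) simp_all
  qed (fact quotient_map_positive quotient_map_unital quotient_map_surj)+
qed

end
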